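(* Let $u\in C_{+,\log}$ be (log, exp)-convex. Then for any integer $p\ge1$, $$|\!|\!|F|\!|\!|_{u,p-1}\le\sqrt e\,\left(2\rho^2\log(1/\rho)\right)^{-1/2}\,\|F\|_{u,p}\qquad\text{for all } F\in\mathcal K_{u,p}.$$
   Context: Let $\mathcal E$ be a real nuclear space with topology given by a sequence of inner product norms $\{|\cdot|_p\}_{p=0}^\infty$; $\mathcal E_p$ is the completion of $\mathcal E$ with respect to $|\cdot|_p$. Standing assumptions: (a) there is a constant $0<\rho<1$ (the $\rho$ in the claim) with $|\cdot|_0\le\rho|\cdot|_1\le\cdots\le\rho^p|\cdot|_p\le\cdots$; (b) for any $p\ge0$ there is $q\ge p$ such that the inclusion $i_{q,p}:\mathcal E_q\to\mathcal E_p$ is Hilbert-Schmidt. For $p\ge q$ one regards $\mathcal E\subset\mathcal E_p\subset\mathcal E_q\subset\mathcal E_0$. The subscript $c$ denotes complexification, with norms extended to complexifications and tensor powers as Hilbert norms (same symbols). $\mathcal E_0$ is identified with its dual; $|\cdot|_{-p}$ is the dual norm of $|\cdot|_p$, so $|\xi|_{-p}=\sup\{|\langle\xi,\eta\rangle|:\eta\in\mathcal E_{p,c},|\eta|_p\le1\}$ for $\xi\in\mathcal E_c$, where $\langle\cdot,\cdot\rangle$ is the complex bilinear extension of the inner product of $\mathcal E_0$ (also used on tensor powers). $\widehat\otimes n$ denotes the symmetric $n$-th Hilbert tensor power. A function $F:\mathcal E_c\to\mathbb C$ is holomorphic on $\mathcal E_c$ if for all $\xi,\eta\in\mathcal E_c$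 the function $z\mapsto F(z\xi+\eta)$ is entire on $\mathbb C$. $C_{+,\log}$ denotes the set of all positive continuous functions $u:[0,\infty)\to(0,\infty)$ with $\lim_{r\to\infty}\frac{\log u(r)}{\log r}=\infty$; its Legendre transform is $\ell_u(t)=\inf_{r>0}u(r)/r^t$, $t\ge0$. A positive continuous $u$ on $[0,\infty)$ is (log, exp)-convex if $x\mapsto\log u(e^x)$ is convex on $\mathbb R$. For holomorphic $F$ on $\mathcal E_c$ with expansion $F(\xi)=\sum_{n=0}^\infty\langle f_n,\xi^{\otimes n}\rangle$, $f_n\in\mathcal E_{p,c}^{\widehat\otimes n}$, put $\|F\|_{u,p}=\left(\sum_{n=0}^\infty\frac{1}{\ell_u(n)}|f_n|_p^2\right)^{1/2}$, and $\mathcal K_{u,p}=\{F:\ \|F\|_{u,p}<\infty\}$. For holomorphic $F$ on $\mathcal E_c$ put $|\!|\!|F|\!|\!|_{u,p}=\sup_{\xi\in\mathcal E_c}|F(\xi)|\,u(|\xi|_{-p}^2)^{-1/2}$. *)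

theory Defs
  imports
    "HOL-Analysis.Analysis"
    "HOL-Combinatorics.Permutations"
    "HOL-Library.Poly_Mapping"
begin

subsection \<open>Scales of Hilbert spaces inside \<open>\<E>\<^sub>0\<close>\<close>

text \<open>
  The Hilbert space \<open>\<E>\<^sub>0\<close> is a whole type \<open>'h\<close>; \<open>\<E>\<close> and the \<open>\<E>\<^sub>p\<close> are linear subspaces of it,
  each \<open>\<E>\<^sub>p\<close> with its own inner product. Predicates below are relative to a carrier \<open>V\<close> and
  a form \<open>B\<close> that is meaningful on \<open>V\<close> only.
\<close>

definition inner_product_on :: "'h::real_vector set \<Rightarrow> ('h \<Rightarrow> 'h \<Rightarrow> real) \<Rightarrow> bool" where
  "inner_product_on V B \<longleftrightarrow>
     (\<forall>x\<in>V. \<forall>y\<in>V. B x y = B y x) \<and>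
     (\<forall>x\<in>V. \<forall>y\<in>V. \<forall>z\<in>V. B (x + y) z = B x z + B y z) \<and>
     (\<forall>c. \<forall>x\<in>V. \<forall>y\<in>V. B (c *\<^sub>R x) y = c * B x y) \<and>
     (\<forall>x\<in>V. 0 \<le> B x x \<and> (B x x = 0 \<longleftrightarrow> x = 0))"

definition form_norm :: "('h \<Rightarrow> 'h \<Rightarrow> real) \<Rightarrow> 'h \<Rightarrow> real" where
  "form_norm B x = sqrt (B x x)"

definition complete_on :: "'h::real_vector set \<Rightarrow> ('h \<Rightarrow> 'h \<Rightarrow> real) \<Rightarrow> bool" where
  "complete_on V B \<longleftrightarrow>
     (\<forall>s :: nat \<Rightarrow> 'h. (\<forall>k. s k \<in> V) \<longrightarrow>
        (\<forall>e>0. \<exists>N. \<forall>j\<ge>N. \<forall>k\<ge>N. form_norm B (s j - s k) < e) \<longrightarrow>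
        (\<exists>x\<in>V. (\<lambda>k. form_norm B (s k - x)) \<longlonglongrightarrow> 0))"

definition dense_on :: "'h::real_vector set \<Rightarrow> 'h set \<Rightarrow> ('h \<Rightarrow> 'h \<Rightarrow> real) \<Rightarrow> bool" where
  "dense_on S V B \<longleftrightarrow> S \<subseteq> V \<and> (\<forall>x\<in>V. \<forall>e>0. \<exists>y\<in>S. form_norm B (x - y) < e)"

definition orthonormal_basis_on :: "'h::real_vector set \<Rightarrow> ('h \<Rightarrow> 'h \<Rightarrow> real) \<Rightarrow> 'h set \<Rightarrow> bool" where
  "orthonormal_basis_on V B b \<longleftrightarrow>
     b \<subseteq> V \<and> (\<forall>x\<in>b. \<forall>y\<in>b. B x y = (if x = y then 1 else 0)) \<and> dense_on (span b) V B"

text \<open>The inclusion of \<open>(V, B)\<close> into a larger space with form \<open>C\<close> is Hilbert-Schmidt.\<close>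

definition hilbert_schmidt_inclusion ::
  "'h::real_vector set \<Rightarrow> ('h \<Rightarrow> 'h \<Rightarrow> real) \<Rightarrow> ('h \<Rightarrow> 'h \<Rightarrow> real) \<Rightarrow> bool" where
  "hilbert_schmidt_inclusion V B C \<longleftrightarrow>
     (\<exists>b. orthonormal_basis_on V B b \<and> (\<lambda>e. (form_norm C e)\<^sup>2) summable_on b)"

text \<open>
  \<open>Ep p\<close> is the completion of \<open>E\<close> in the \<open>p\<close>-th norm. The inclusions \<open>Ep q \<rightarrow> Ep p\<close> are the continuous
  extensions of the identity of \<open>E\<close>, so \<open>norm_mono\<close>, which the source states on \<open>E\<close>, is
  stated on the completions; this is what makes these extensions plain set inclusions.
\<close>

locale nuclear_scale =
  fixes E :: "'h::{real_inner,complete_space} set"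
    and Ep :: "nat \<Rightarrow> 'h set"
    and ip :: "nat \<Rightarrow> 'h \<Rightarrow> 'h \<Rightarrow> real"
    and \<rho> :: real
  assumes subspace_E: "subspace E"
    and subspace_Ep: "\<And>p. subspace (Ep p)"
    and Ep_0: "Ep 0 = UNIV" "ip 0 = inner"
    and ip: "\<And>p. inner_product_on (Ep p) (ip p)"
    and complete: "\<And>p. complete_on (Ep p) (ip p)"
    and dense: "\<And>p. dense_on E (Ep p) (ip p)"
    and rho: "0 < \<rho>" "\<rho> < 1"
    and Ep_mono: "\<And>p. Ep (Suc p) \<subseteq> Ep p"
    and norm_mono: "\<And>p x. x \<in> Ep (Suc p) \<Longrightarrow>
          \<rho> ^ p * form_norm (ip p) x \<le> \<rho> ^ Suc p * form_norm (ip (Suc p)) x"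
    and nuclear: "\<And>p. \<exists>q\<ge>p. hilbert_schmidt_inclusion (Ep q) (ip q) (ip p)"

subsection \<open>Complexification\<close>

text \<open>A pair \<open>(x, y)\<close> stands for \<open>x + \<i>y\<close>; the complexification of a subspace \<open>V\<close> is \<open>V \<times> V\<close>.\<close>

definition cplx :: "'h set \<Rightarrow> ('h \<times> 'h) set" where
  "cplx V = V \<times> V"

definition cscale :: "complex \<Rightarrow> 'h::real_vector \<times> 'h \<Rightarrow> 'h \<times> 'h" where
  "cscale z \<xi> = (Re z *\<^sub>R fst \<xi> - Im z *\<^sub>R snd \<xi>, Re z *\<^sub>R snd \<xi> + Im z *\<^sub>R fst \<xi>)"

text \<open>The complex bilinear and the sesquilinear (linear in the first slot) extension of \<open>B\<close>.\<close>

definition cbil :: "('h \<Rightarrow> 'h \<Rightarrow> real) \<Rightarrow> 'h \<times> 'h \<Rightarrow> 'h \<times> 'h \<Rightarrow> complex" where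
  "cbil B \<xi> \<eta> = Complex (B (fst \<xi>) (fst \<eta>) - B (snd \<xi>) (snd \<eta>))
                        (B (fst \<xi>) (snd \<eta>) + B (snd \<xi>) (fst \<eta>))"

definition cherm :: "('h \<Rightarrow> 'h \<Rightarrow> real) \<Rightarrow> 'h \<times> 'h \<Rightarrow> 'h \<times> 'h \<Rightarrow> complex" where
  "cherm B \<xi> \<eta> = Complex (B (fst \<xi>) (fst \<eta>) + B (snd \<xi>) (snd \<eta>))
                         (B (snd \<xi>) (fst \<eta>) - B (fst \<xi>) (snd \<eta>))"

definition cnorm :: "('h \<Rightarrow> 'h \<Rightarrow> real) \<Rightarrow> 'h \<times> 'h \<Rightarrow> real" where
  "cnorm B \<xi> = sqrt (Re (cherm B \<xi> \<xi>))"

text \<open>\<open>dual_norm V B\<close>, with \<open>V = Ep p\<close> and \<open>B = ip p\<close>, is the norm with index \<open>-p\<close>.\<close>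

definition dual_norm :: "'h::real_inner set \<Rightarrow> ('h \<Rightarrow> 'h \<Rightarrow> real) \<Rightarrow> 'h \<times> 'h \<Rightarrow> real" where
  "dual_norm V B \<xi> = (SUP \<eta>\<in>{\<eta>\<in>cplx V. cnorm B \<eta> \<le> 1}. cmod (cbil inner \<xi> \<eta>))"

definition holomorphic_cplx :: "'h::real_vector set \<Rightarrow> ('h \<times> 'h \<Rightarrow> complex) \<Rightarrow> bool" where
  "holomorphic_cplx E F \<longleftrightarrow>
     (\<forall>\<xi>\<in>cplx E. \<forall>\<eta>\<in>cplx E. (\<lambda>z. F (cscale z \<xi> + \<eta>)) holomorphic_on UNIV)"

subsection \<open>Symmetric Hilbert tensor powers\<close>

text \<open>
  A formal tensor is an element of the free complex vector space on the lists of vectors; the list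
  \<open>[x\<^sub>1, \<dots>, x\<^sub>n]\<close> stands for \<open>x\<^sub>1 \<otimes> \<dots> \<otimes> x\<^sub>n\<close>. The formal tensors whose seminorm \<open>tensor_norm\<close> is \<open>0\<close>
  are exactly those that vanish in the algebraic tensor power. Hence the Hilbert tensor power, i.e.
  the completion of the algebraic one, is the set of Cauchy sequences of formal tensors modulo
  sequences whose seminorms tend to \<open>0\<close>.
\<close>

type_synonym 'h ftensor = "('h \<times> 'h) list \<Rightarrow>\<^sub>0 complex"

definition ftensors :: "'h set \<Rightarrow> nat \<Rightarrow> 'h ftensor set" where
  "ftensors V n =
     {t. \<forall>xs\<in>Poly_Mapping.keys t. length xs = n \<and> set xs \<subseteq> cplx V}"

definition tensor_bil :: "('h \<Rightarrow> 'h \<Rightarrow> real) \<Rightarrow> 'h ftensor \<Rightarrow> 'h ftensor \<Rightarrow> complex" where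
  "tensor_bil B s t =
     (\<Sum>xs\<in>Poly_Mapping.keys s. \<Sum>ys\<in>Poly_Mapping.keys t.
        Poly_Mapping.lookup s xs * Poly_Mapping.lookup t ys * prod_list (map2 (cbil B) xs ys))"

definition tensor_herm :: "('h \<Rightarrow> 'h \<Rightarrow> real) \<Rightarrow> 'h ftensor \<Rightarrow> 'h ftensor \<Rightarrow> complex" where
  "tensor_herm B s t =
     (\<Sum>xs\<in>Poly_Mapping.keys s. \<Sum>ys\<in>Poly_Mapping.keys t.
        Poly_Mapping.lookup s xs * cnj (Poly_Mapping.lookup t ys)
          * prod_list (map2 (cherm B) xs ys))"

definition tensor_norm :: "('h \<Rightarrow> 'h \<Rightarrow> real) \<Rightarrow> 'h ftensor \<Rightarrow> real" where
  "tensor_norm B t = sqrt (Re (tensor_herm B t t))"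

definition permute_tensor :: "(nat \<Rightarrow> nat) \<Rightarrow> 'h ftensor \<Rightarrow> 'h ftensor" where
  "permute_tensor \<sigma> t =
     (\<Sum>xs\<in>Poly_Mapping.keys t.
        Poly_Mapping.single (permute_list \<sigma> xs) (Poly_Mapping.lookup t xs))"

definition tensor_power_vec :: "'h \<times> 'h \<Rightarrow> nat \<Rightarrow> 'h ftensor" where
  "tensor_power_vec \<xi> n = Poly_Mapping.single (replicate n \<xi>) 1"

definition tensor_cauchy :: "'h set \<Rightarrow> ('h \<Rightarrow> 'h \<Rightarrow> real) \<Rightarrow> nat \<Rightarrow> (nat \<Rightarrow> 'h ftensor) set" where
  "tensor_cauchy V B n =
     {s. (\<forall>k. s k \<in> ftensors V n) \<and>
         (\<forall>e>0. \<exists>N. \<forall>j\<ge>N. \<forall>k\<ge>N. tensor_norm B (s j - s k) < e)}"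

definition tensor_eq ::
  "'h set \<Rightarrow> ('h \<Rightarrow> 'h \<Rightarrow> real) \<Rightarrow> nat \<Rightarrow> ((nat \<Rightarrow> 'h ftensor) \<times> (nat \<Rightarrow> 'h ftensor)) set" where
  "tensor_eq V B n =
     {(s, t). s \<in> tensor_cauchy V B n \<and> t \<in> tensor_cauchy V B n \<and>
              (\<lambda>k. tensor_norm B (s k - t k)) \<longlonglongrightarrow> 0}"

definition hilbert_tensor_power ::
  "'h set \<Rightarrow> ('h \<Rightarrow> 'h \<Rightarrow> real) \<Rightarrow> nat \<Rightarrow> (nat \<Rightarrow> 'h ftensor) set set" where
  "hilbert_tensor_power V B n = tensor_cauchy V B n // tensor_eq V B n"

definition sym_hilbert_tensor_power ::
  "'h set \<Rightarrow> ('h \<Rightarrow> 'h \<Rightarrow> real) \<Rightarrow> nat \<Rightarrow> (nat \<Rightarrow> 'h ftensor) set set" where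
  "sym_hilbert_tensor_power V B n =
     {f \<in> hilbert_tensor_power V B n.
        \<forall>\<sigma>. \<sigma> permutes {..<n} \<longrightarrow> (\<forall>s\<in>f. (\<lambda>k. permute_tensor \<sigma> (s k)) \<in> f)}"

text \<open>
  Norm and pairing on the completion are limits along a representing Cauchy sequence and do not
  depend on the representative. The pairing is that of \<open>\<E>\<^sub>0\<close>, which is continuous in the norm of any
  \<open>\<E>\<^sub>p\<close>.
\<close>

definition hilbert_tensor_norm :: "('h \<Rightarrow> 'h \<Rightarrow> real) \<Rightarrow> (nat \<Rightarrow> 'h ftensor) set \<Rightarrow> real" where
  "hilbert_tensor_norm B f = lim (\<lambda>k. tensor_norm B ((SOME s. s \<in> f) k))"

definition tensor_pairing :: "(nat \<Rightarrow> 'h::real_inner ftensor) set \<Rightarrow> 'h ftensor \<Rightarrow> complex" where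
  "tensor_pairing f t = lim (\<lambda>k. tensor_bil inner ((SOME s. s \<in> f) k) t)"

subsection \<open>Growth functions and the two norms\<close>

text \<open>Growth functions live on \<open>[0, \<infinity>)\<close>; values at negative arguments are irrelevant.\<close>

definition C_plus_log :: "(real \<Rightarrow> real) set" where
  "C_plus_log = {u. continuous_on {0..} u \<and> (\<forall>r\<ge>0. u r > 0) \<and>
                    filterlim (\<lambda>r. ln (u r) / ln r) at_top at_top}"

definition log_exp_convex :: "(real \<Rightarrow> real) \<Rightarrow> bool" where
  "log_exp_convex u \<longleftrightarrow> convex_on UNIV (\<lambda>x. ln (u (exp x)))"

definition legendre :: "(real \<Rightarrow> real) \<Rightarrow> real \<Rightarrow> real" where
  "legendre u t = (INF r\<in>{0<..}. u r / r powr t)"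

definition has_expansion ::
  "'h::real_inner set \<Rightarrow> 'h set \<Rightarrow> ('h \<Rightarrow> 'h \<Rightarrow> real) \<Rightarrow> ('h \<times> 'h \<Rightarrow> complex)
    \<Rightarrow> (nat \<Rightarrow> (nat \<Rightarrow> 'h ftensor) set) \<Rightarrow> bool" where
  "has_expansion E V B F f \<longleftrightarrow>
     (\<forall>n. f n \<in> sym_hilbert_tensor_power V B n) \<and>
     (\<forall>\<xi>\<in>cplx E. (\<lambda>n. tensor_pairing (f n) (tensor_power_vec \<xi> n)) sums F \<xi>)"

definition coeff_norm ::
  "(real \<Rightarrow> real) \<Rightarrow> ('h \<Rightarrow> 'h \<Rightarrow> real) \<Rightarrow> (nat \<Rightarrow> (nat \<Rightarrow> 'h ftensor) set) \<Rightarrow> ennreal" where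
  "coeff_norm u B f =
     (let a = (\<lambda>n. 1 / legendre u (real n) * (hilbert_tensor_norm B (f n))\<^sup>2)
      in if summable a then ennreal (sqrt (suminf a)) else \<infinity>)"

text \<open>
  The coefficients of an expansion are determined by \<open>F\<close>, so the infimum ranges over at most one
  sequence; it makes the norm \<open>\<infinity>\<close> if \<open>F\<close> has no expansion with coefficients of level \<open>p\<close>.
\<close>

definition norm_K ::
  "'h::real_inner set \<Rightarrow> (nat \<Rightarrow> 'h set) \<Rightarrow> (nat \<Rightarrow> 'h \<Rightarrow> 'h \<Rightarrow> real)
    \<Rightarrow> (real \<Rightarrow> real) \<Rightarrow> nat \<Rightarrow> ('h \<times> 'h \<Rightarrow> complex) \<Rightarrow> ennreal" where
  "norm_K E Ep ip u p F =
     (INF f\<in>{f. has_expansion E (Ep p) (ip p) F f}. coeff_norm u (ip p) f)"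

definition space_K ::
  "'h::real_inner set \<Rightarrow> (nat \<Rightarrow> 'h set) \<Rightarrow> (nat \<Rightarrow> 'h \<Rightarrow> 'h \<Rightarrow> real)
    \<Rightarrow> (real \<Rightarrow> real) \<Rightarrow> nat \<Rightarrow> ('h \<times> 'h \<Rightarrow> complex) set" where
  "space_K E Ep ip u p = {F. holomorphic_cplx E F \<and> norm_K E Ep ip u p F < \<infinity>}"

definition norm_sup ::
  "'h::real_inner set \<Rightarrow> (nat \<Rightarrow> 'h set) \<Rightarrow> (nat \<Rightarrow> 'h \<Rightarrow> 'h \<Rightarrow> real)
    \<Rightarrow> (real \<Rightarrow> real) \<Rightarrow> nat \<Rightarrow> ('h \<times> 'h \<Rightarrow> complex) \<Rightarrow> ennreal" where
  "norm_sup E Ep ip u p F =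
     (SUP \<xi>\<in>cplx E. ennreal (cmod (F \<xi>) * u ((dual_norm (Ep p) (ip p) \<xi>)\<^sup>2) powr (-1/2)))"

end

theory Submission
  imports Defs
begin

text \<open>
  Write \<open>d\<^sub>p\<close> for the dual norm of \<open>\<xi>\<close> at level \<open>p\<close>. Three estimates, combined by the
  Cauchy-Schwarz inequality for series, give the theorem.

  (1) \<open>\<bar>\<langle>f\<^sub>n, \<xi>\<^sup>\<otimes>\<^sup>n\<rangle>\<bar> \<le> \<bar>f\<^sub>n\<bar>\<^sub>p d\<^sub>p\<^sup>n\<close> (\<open>tensor_pairing_le\<close>). By continuity it is enough to treat an
  algebraic tensor, which involves only finitely many vectors. Orthonormalizing these in the \<open>p\<close>-th
  inner product turns the tensor norm into the Euclidean norm of finitely many coordinates, indexed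
  by multi-indices, and the pairing into a finite scalar product; the squared Euclidean norm of the
  coordinates of \<open>\<xi>\<^sup>\<otimes>\<^sup>n\<close> factors as an \<open>n\<close>-th power whose base is at most \<open>d\<^sub>p\<^sup>2\<close>.

  (2) \<open>d\<^sub>p \<le> \<rho> d\<^sub>p\<^sub>-\<^sub>1\<close> (\<open>dual_norm_Suc\<close>), since by the scale inequality the unit ball of level \<open>p\<close> lies in
  \<open>\<rho>\<close> times the unit ball of level \<open>p - 1\<close>.

  (3) \<open>\<ell>\<^sub>u(n) r\<^sup>n \<le> u(r)\<close> for \<open>r \<ge> 0\<close> (\<open>legendre_times_power_le\<close>), by the definition of \<open>\<ell>\<^sub>u\<close> as an infimum.

  With \<open>r = d\<^sub>p\<^sub>-\<^sub>1\<^sup>2\<close>, the Cauchy-Schwarz inequality bounds \<open>\<bar>F(\<xi>)\<bar>\<^sup>2\<close> by \<open>\<Sum> \<bar>f\<^sub>n\<bar>\<^sub>p\<^sup>2 / \<ell>\<^sub>u(n)\<close> times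
  \<open>\<Sum> \<ell>\<^sub>u(n) d\<^sub>p\<^sup>2\<^sup>n \<le> \<Sum> \<rho>\<^sup>2\<^sup>n u(r) = u(r) / (1 - \<rho>\<^sup>2)\<close>. This constant is below the claimed one, because
  \<open>ln y \<le> y - 1\<close> at \<open>y = 1 / \<rho>\<^sup>2\<close> gives \<open>2 \<rho>\<^sup>2 ln (1 / \<rho>) \<le> 1 - \<rho>\<^sup>2\<close> (\<open>geometric_constant_le\<close>).
\<close>

section \<open>Finite orthonormal frames\<close>

locale inner_product_subspace =
  fixes V :: "'h::real_inner set" and B :: "'h \<Rightarrow> 'h \<Rightarrow> real"
  assumes subspace_V: "subspace V" and ip: "inner_product_on V B"
begin

lemma form_sym: "x \<in> V \<Longrightarrow> y \<in> V \<Longrightarrow> B x y = B y x"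
  and add_left: "x \<in> V \<Longrightarrow> y \<in> V \<Longrightarrow> z \<in> V \<Longrightarrow> B (x + y) z = B x z + B y z"
  and scale_left: "x \<in> V \<Longrightarrow> y \<in> V \<Longrightarrow> B (c *\<^sub>R x) y = c * B x y"
  and nonneg: "x \<in> V \<Longrightarrow> 0 \<le> B x x"
  and eq_0_iff: "x \<in> V \<Longrightarrow> B x x = 0 \<longleftrightarrow> x = 0"
  using ip by (simp_all add: inner_product_on_def)

lemma zero_left: "y \<in> V \<Longrightarrow> B 0 y = 0"
  using scale_left[of 0 y 0] subspace_0[OF subspace_V] by simp

lemma sum_scale_left:
  assumes "\<And>i. i \<in> I \<Longrightarrow> v i \<in> V" and "y \<in> V"
  shows "B (\<Sum>i\<in>I. c i *\<^sub>R v i) y = (\<Sum>i\<in>I. c i * B (v i) y)"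
  using assms(1)
proof (induction I rule: infinite_finite_induct)
  case (insert i I)
  have V: "v i \<in> V" "(\<Sum>i\<in>I. c i *\<^sub>R v i) \<in> V" "c i *\<^sub>R v i \<in> V"
    using insert.prems by (auto intro!: subspace_sum subspace_scale subspace_V)
  have "B (\<Sum>i\<in>I. c i *\<^sub>R v i) y = (\<Sum>i\<in>I. c i * B (v i) y)"
    using insert by blast
  then show ?case
    using add_left[OF V(3,2) assms(2)] scale_left[OF V(1) assms(2)] insert.hyps by simp
qed (simp_all add: zero_left[OF assms(2)])

lemma diff_left:
  assumes "x \<in> V" "y \<in> V" "z \<in> V"
  shows "B (x - y) z = B x z - B y z"
proof -
  have "(-1) *\<^sub>R y \<in> V" using subspace_V assms(2) by (rule subspace_scale)
  then show ?thesis
    using add_left[OF assms(1) _ assms(3), of "(-1) *\<^sub>R y"] scale_left[OF assms(2,3), of "-1"]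
    by simp
qed

definition orthonormal_frame :: "nat \<Rightarrow> (nat \<Rightarrow> 'h) \<Rightarrow> bool" where
  "orthonormal_frame m e \<longleftrightarrow>
     (\<forall>i<m. e i \<in> V) \<and> (\<forall>i<m. \<forall>j<m. B (e i) (e j) = (if i = j then 1 else 0))"

text \<open>
  A vector is recorded here by its Fourier expansion, so membership is itself the equation that the
  coordinate computations below rewrite with.
\<close>

definition frame_span :: "nat \<Rightarrow> (nat \<Rightarrow> 'h) \<Rightarrow> 'h set" where
  "frame_span m e = {x \<in> V. x = (\<Sum>i<m. B x (e i) *\<^sub>R e i)}"

lemma frame_span_Suc:
  assumes "orthonormal_frame (Suc m) e"
  shows "frame_span m e \<subseteq> frame_span (Suc m) e"
proof
  fix x assume x: "x \<in> frame_span m e"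
  have e: "e m \<in> V" "\<And>i. i < m \<Longrightarrow> e i \<in> V" "\<And>i. i < m \<Longrightarrow> B (e i) (e m) = 0"
    using assms by (auto simp: orthonormal_frame_def)
  have "B x (e m) = B (\<Sum>i<m. B x (e i) *\<^sub>R e i) (e m)"
    using x by (simp add: frame_span_def)
  also have "\<dots> = 0"
    using e by (subst sum_scale_left) auto
  finally show "x \<in> frame_span (Suc m) e"
    using x by (simp add: frame_span_def)
qed

text \<open>
  One Gram-Schmidt step per vector: the residual \<open>r\<close> of the new vector \<open>x\<close> is orthogonal to the
  frame, and it either vanishes or is normalized and appended.
\<close>

lemma exists_orthonormal_frame:
  assumes "finite S" and "S \<subseteq> V"
  shows "\<exists>m e. orthonormal_frame m e \<and> S \<subseteq> frame_span m e"
  using assms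
proof (induction S rule: finite_induct)
  case empty
  then show ?case by (intro exI[of _ 0]) (auto simp: orthonormal_frame_def)
next
  case (insert x S)
  then obtain m e where me: "orthonormal_frame m e" "S \<subseteq> frame_span m e" by auto
  have x: "x \<in> V" using insert by simp
  have eV: "\<And>i. i < m \<Longrightarrow> e i \<in> V"
    and on: "\<And>i j. i < m \<Longrightarrow> j < m \<Longrightarrow> B (e i) (e j) = (if i = j then 1 else 0)"
    using me(1) by (auto simp: orthonormal_frame_def)
  define y where "y = (\<Sum>i<m. B x (e i) *\<^sub>R e i)"
  have y: "y \<in> V" unfolding y_def using eV by (auto intro!: subspace_sum subspace_scale subspace_V)
  define r where "r = x - y"
  have r: "r \<in> V" using x y unfolding r_def by (rule subspace_diff[OF subspace_V])
  have re: "B r (e j) = 0" if "j < m" for j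
  proof -
    have "B y (e j) = (\<Sum>i<m. B x (e i) * (if i = j then 1 else 0))"
      unfolding y_def using eV on that by (subst sum_scale_left) auto
    then have "B y (e j) = B x (e j)" using that by (simp add: if_distrib cong: if_cong)
    then show ?thesis using that x y eV by (simp add: r_def diff_left)
  qed
  show ?case
  proof (cases "r = 0")
    case True
    then have "x \<in> frame_span m e" using x by (simp add: frame_span_def r_def y_def)
    then show ?thesis using me by blast
  next
    case False
    then have pos: "0 < B r r" using nonneg[OF r] eq_0_iff[OF r] by linarith
    define c where "c = 1 / sqrt (B r r)"
    have c: "c > 0" "c * c * B r r = 1" using pos by (auto simp: c_def)
    define e' where "e' = e(m := c *\<^sub>R r)"
    have cr: "c *\<^sub>R r \<in> V" using r by (rule subspace_scale[OF subspace_V])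
    have orth: "B (c *\<^sub>R r) (e j) = 0" "B (e j) (c *\<^sub>R r) = 0" if "j < m" for j
      using that re eV r cr by (simp_all add: scale_left form_sym[of "e j"])
    have unit: "B (c *\<^sub>R r) (c *\<^sub>R r) = 1"
      using r cr c by (simp add: scale_left form_sym[of r "c *\<^sub>R r"])
    have on': "orthonormal_frame (Suc m) e'"
      unfolding orthonormal_frame_def e'_def
      using eV on cr orth unit by (auto simp: less_Suc_eq)
    have "frame_span m e = frame_span m e'"
      by (auto simp: frame_span_def e'_def)
    then have 1: "S \<subseteq> frame_span (Suc m) e'"
      using me(2) frame_span_Suc[OF on'] by blast
    have "B y (c *\<^sub>R r) = 0"
      unfolding y_def using eV cr orth by (subst sum_scale_left) auto
    then have "B x (c *\<^sub>R r) = B r (c *\<^sub>R r)"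
      using x y cr by (simp add: r_def diff_left)
    also have "\<dots> = c * B r r"
      using r cr by (simp add: form_sym[of r "c *\<^sub>R r"] scale_left)
    finally have "B x (c *\<^sub>R r) *\<^sub>R (c *\<^sub>R r) = r" using c by (simp add: mult.commute mult.left_commute)
    then have "x = (\<Sum>i<Suc m. B x (e' i) *\<^sub>R e' i)"
      by (simp add: e'_def r_def flip: y_def)
    then have "x \<in> frame_span (Suc m) e'" using x by (simp add: frame_span_def)
    then show ?thesis using on' 1 by blast
  qed
qed

lemma parseval:
  assumes "orthonormal_frame m e" "x \<in> frame_span m e" "y \<in> V"
  shows "B x y = (\<Sum>j<m. B x (e j) * B y (e j))"
proof -
  have e: "\<And>i. i < m \<Longrightarrow> e i \<in> V" using assms(1) by (auto simp: orthonormal_frame_def)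
  have "B x y = B (\<Sum>i<m. B x (e i) *\<^sub>R e i) y" using assms(2) by (simp add: frame_span_def)
  also have "\<dots> = (\<Sum>j<m. B x (e j) * B (e j) y)" using e assms(3) by (subst sum_scale_left) auto
  finally show ?thesis using e assms(3) by (simp add: form_sym)
qed

section \<open>Coordinates of formal tensors\<close>

definition coord :: "(nat \<Rightarrow> 'h) \<Rightarrow> 'h \<times> 'h \<Rightarrow> nat \<Rightarrow> complex" where
  "coord e \<xi> j = Complex (B (fst \<xi>) (e j)) (B (snd \<xi>) (e j))"

text \<open>
  The coefficient of \<open>s\<close> at the elementary tensor \<open>e (J 0) \<otimes> \<dots> \<otimes> e (J (n - 1))\<close>, when all factors of
  \<open>s\<close> lie in the complex span of the frame.
\<close>

definition tensor_coord :: "(nat \<Rightarrow> 'h) \<Rightarrow> nat \<Rightarrow> 'h ftensor \<Rightarrow> (nat \<Rightarrow> nat) \<Rightarrow> complex" where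
  "tensor_coord e n s J =
     (\<Sum>xs\<in>Poly_Mapping.keys s. Poly_Mapping.lookup s xs * (\<Prod>i<n. coord e (xs ! i) (J i)))"

abbreviation multi_indices :: "nat \<Rightarrow> nat \<Rightarrow> (nat \<Rightarrow> nat) set" where
  "multi_indices m n \<equiv> {..<n} \<rightarrow>\<^sub>E {..<m}"

lemma cherm_coord:
  assumes "orthonormal_frame m e" "\<xi> \<in> cplx (frame_span m e)" "\<eta> \<in> cplx (frame_span m e)"
  shows "cherm B \<xi> \<eta> = (\<Sum>j<m. coord e \<xi> j * cnj (coord e \<eta> j))"
proof -
  have "B x y = (\<Sum>j<m. B x (e j) * B y (e j))"
    if "x \<in> {fst \<xi>, snd \<xi>}" "y \<in> {fst \<eta>, snd \<eta>}" for x y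
    using that assms by (intro parseval) (auto simp: cplx_def frame_span_def)
  then show ?thesis
    by (simp add: complex_eq_iff cherm_def coord_def sum.distrib sum_subtractf Re_sum Im_sum)
qed

lemma cbil_inner_coord:
  assumes "\<xi> \<in> cplx (frame_span m e)"
  shows "cbil inner \<xi> \<eta> = (\<Sum>j<m. coord e \<xi> j * Complex (e j \<bullet> fst \<eta>) (e j \<bullet> snd \<eta>))"
proof -
  have "x \<bullet> y = (\<Sum>j<m. B x (e j) * (e j \<bullet> y))" if "x \<in> {fst \<xi>, snd \<xi>}" for x y
  proof -
    have "x = (\<Sum>j<m. B x (e j) *\<^sub>R e j)" using that assms by (auto simp: cplx_def frame_span_def)
    then have "x \<bullet> y = (\<Sum>j<m. B x (e j) *\<^sub>R e j) \<bullet> y" by simp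
    then show ?thesis by (simp add: inner_sum_left)
  qed
  then show ?thesis
    by (simp add: complex_eq_iff cbil_def coord_def sum.distrib sum_subtractf Re_sum Im_sum)
qed

text \<open>
  Multiplying out a product of \<open>n\<close> finite sums produces the sum over multi-indices. Both the
  sesquilinear form and the pairing with \<open>\<xi>\<^sup>\<otimes>\<^sup>n\<close> get their coordinate formulas from this.
\<close>

lemma prod_list_map2_sum:
  fixes g :: "'a \<Rightarrow> 'b \<Rightarrow> complex"
  assumes "length xs = n" "length ys = n"
    and "\<And>i. i < n \<Longrightarrow> g (xs ! i) (ys ! i) = (\<Sum>j<m. a (xs ! i) j * b (ys ! i) j)"
  shows "prod_list (map2 g xs ys)
           = (\<Sum>J\<in>multi_indices m n. (\<Prod>i<n. a (xs ! i) (J i)) * (\<Prod>i<n. b (ys ! i) (J i)))"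
proof -
  have "prod_list (map2 g xs ys) = (\<Prod>i<n. g (xs ! i) (ys ! i))"
    using assms(1,2) by (simp add: prod.list_conv_set_nth atLeast0LessThan)
  also have "\<dots> = (\<Prod>i<n. \<Sum>j<m. a (xs ! i) j * b (ys ! i) j)"
    using assms(3) by simp
  also have "\<dots> = (\<Sum>J\<in>multi_indices m n. \<Prod>i<n. a (xs ! i) (J i) * b (ys ! i) (J i))"
    by (rule prod_sum_PiE) auto
  finally show ?thesis by (simp add: prod.distrib)
qed

lemma sum_sum_mult_rearrange:
  fixes a b :: "'a \<Rightarrow> complex"
  shows "(\<Sum>x\<in>X. \<Sum>y\<in>Y. a x * b y * (\<Sum>j\<in>I. f x j * g y j))
           = (\<Sum>j\<in>I. (\<Sum>x\<in>X. a x * f x j) * (\<Sum>y\<in>Y. b y * g y j))"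
proof -
  have "(\<Sum>x\<in>X. \<Sum>y\<in>Y. a x * b y * (\<Sum>j\<in>I. f x j * g y j))
      = (\<Sum>x\<in>X. \<Sum>y\<in>Y. \<Sum>j\<in>I. (a x * f x j) * (b y * g y j))"
    by (simp add: sum_distrib_left mult_ac)
  also have "\<dots> = (\<Sum>x\<in>X. \<Sum>j\<in>I. \<Sum>y\<in>Y. (a x * f x j) * (b y * g y j))"
    by (rule sum.cong[OF refl], rule sum.swap)
  also have "\<dots> = (\<Sum>j\<in>I. \<Sum>x\<in>X. \<Sum>y\<in>Y. (a x * f x j) * (b y * g y j))"
    by (rule sum.swap)
  finally show ?thesis
    unfolding sum_product .
qed

lemma ftensorsD:
  assumes "s \<in> ftensors U n" "xs \<in> Poly_Mapping.keys s"
  shows "length xs = n" "i < n \<Longrightarrow> xs ! i \<in> cplx U"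
proof -
  have xs: "length xs = n" "set xs \<subseteq> cplx U"
    using assms by (auto simp: ftensors_def)
  show "length xs = n" by (fact xs)
  show "xs ! i \<in> cplx U" if "i < n"
    using xs that nth_mem[of i xs] by blast
qed

lemma tensor_herm_coord:
  assumes "orthonormal_frame m e" "s \<in> ftensors (frame_span m e) n" "t \<in> ftensors (frame_span m e) n"
  shows "tensor_herm B s t
           = (\<Sum>J\<in>multi_indices m n. tensor_coord e n s J * cnj (tensor_coord e n t J))"
proof -
  let ?s = "Poly_Mapping.lookup s" and ?t = "Poly_Mapping.lookup t"
  let ?P = "\<lambda>xs J. \<Prod>i<n. coord e (xs ! i) (J i)"
  have "tensor_herm B s t =
     (\<Sum>xs\<in>Poly_Mapping.keys s. \<Sum>ys\<in>Poly_Mapping.keys t. ?s xs * cnj (?t ys)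
        * (\<Sum>J\<in>multi_indices m n. ?P xs J * (\<Prod>i<n. cnj (coord e (ys ! i) (J i)))))"
    unfolding tensor_herm_def
  proof (intro sum.cong[OF refl] arg_cong2[where f = "(*)", OF refl])
    fix xs ys assume "xs \<in> Poly_Mapping.keys s" "ys \<in> Poly_Mapping.keys t"
    note xs = ftensorsD[OF assms(2) this(1)] and ys = ftensorsD[OF assms(3) this(2)]
    show "prod_list (map2 (cherm B) xs ys)
      = (\<Sum>J\<in>multi_indices m n. ?P xs J * (\<Prod>i<n. cnj (coord e (ys ! i) (J i))))"
      using xs ys cherm_coord[OF assms(1)] by (intro prod_list_map2_sum) auto
  qed
  also have "\<dots> = (\<Sum>J\<in>multi_indices m n. (\<Sum>xs\<in>Poly_Mapping.keys s. ?s xs * ?P xs J) *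
      (\<Sum>ys\<in>Poly_Mapping.keys t. cnj (?t ys) * (\<Prod>i<n. cnj (coord e (ys ! i) (J i)))))"
    by (rule sum_sum_mult_rearrange)
  finally show ?thesis
    unfolding tensor_coord_def cnj_sum complex_cnj_mult cnj_prod .
qed

text \<open>
  Here the seminorm is seen to be a Euclidean norm; positivity, the triangle inequality and
  Cauchy-Schwarz for formal tensors are inherited from it.
\<close>

lemma tensor_norm_coord:
  assumes "orthonormal_frame m e" "s \<in> ftensors (frame_span m e) n"
  shows "tensor_norm B s = L2_set (\<lambda>J. cmod (tensor_coord e n s J)) (multi_indices m n)"
proof -
  have "tensor_herm B s s = of_real (\<Sum>J\<in>multi_indices m n. (cmod (tensor_coord e n s J))\<^sup>2)"
    unfolding tensor_herm_coord[OF assms assms(2)] of_real_sum complex_norm_square ..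
  then show ?thesis
    by (simp only: tensor_norm_def L2_set_def Re_complex_of_real)
qed

lemma tensor_coord_superset:
  assumes "finite K" "Poly_Mapping.keys s \<subseteq> K"
  shows "tensor_coord e n s J
           = (\<Sum>xs\<in>K. Poly_Mapping.lookup s xs * (\<Prod>i<n. coord e (xs ! i) (J i)))"
  unfolding tensor_coord_def using assms
  by (intro sum.mono_neutral_left) (simp_all add: not_in_keys_iff_lookup_eq_zero)

lemma tensor_coord_diff: "tensor_coord e n (s - t) J = tensor_coord e n s J - tensor_coord e n t J"
proof -
  let ?K = "Poly_Mapping.keys s \<union> Poly_Mapping.keys t"
  have K: "finite ?K" by simp
  show ?thesis
    unfolding tensor_coord_superset[OF K Un_upper1] tensor_coord_superset[OF K Un_upper2]
      tensor_coord_superset[OF K keys_diff]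
    by (simp only: lookup_minus sum_subtractf left_diff_distrib)
qed

lemma ftensors_diff:
  assumes "s \<in> ftensors U n" "t \<in> ftensors U n"
  shows "s - t \<in> ftensors U n"
proof -
  have "\<forall>xs\<in>Poly_Mapping.keys s \<union> Poly_Mapping.keys t. length xs = n \<and> set xs \<subseteq> cplx U"
    using assms unfolding ftensors_def ball_Un by simp
  then have "\<forall>xs\<in>Poly_Mapping.keys (s - t). length xs = n \<and> set xs \<subseteq> cplx U"
    by (rule bspec[THEN ballI, OF _ subsetD[OF keys_diff]])
  then show ?thesis by (simp add: ftensors_def)
qed

lemma exists_tensor_frame:
  assumes "s \<in> ftensors V n" "t \<in> ftensors V n"
  obtains m e where "orthonormal_frame m e"
    "s \<in> ftensors (frame_span m e) n" "t \<in> ftensors (frame_span m e) n"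
proof -
  define X where "X = (\<Union>xs\<in>Poly_Mapping.keys s \<union> Poly_Mapping.keys t. set xs)"
  have "finite (fst ` X \<union> snd ` X)" by (auto simp: X_def)
  moreover have "X \<subseteq> cplx V"
    using assms unfolding X_def ftensors_def by auto
  then have "fst ` X \<union> snd ` X \<subseteq> V"
    by (auto simp: cplx_def)
  ultimately obtain m e where me: "orthonormal_frame m e" "fst ` X \<union> snd ` X \<subseteq> frame_span m e"
    using exists_orthonormal_frame[of "fst ` X \<union> snd ` X"] by auto
  then have "X \<subseteq> cplx (frame_span m e)" by (auto simp: cplx_def mem_Times_iff)
  then have "s \<in> ftensors (frame_span m e) n" "t \<in> ftensors (frame_span m e) n"
    using assms by (auto simp: ftensors_def X_def)
  then show ?thesis using that me(1) by blast
qed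

lemma tensor_norm_nonneg: 
  assumes "s \<in> ftensors V n" shows "0 \<le> tensor_norm B s"
proof -
  obtain m e where "orthonormal_frame m e" "s \<in> ftensors (frame_span m e) n"
    using exists_tensor_frame[OF assms assms] by blast
  from tensor_norm_coord[OF this] show ?thesis by (simp add: L2_set_nonneg)
qed

lemma tensor_norm_triangle:
  assumes "s \<in> ftensors V n" "t \<in> ftensors V n"
  shows "\<bar>tensor_norm B s - tensor_norm B t\<bar> \<le> tensor_norm B (s - t)"
proof -
  obtain m e where me: "orthonormal_frame m e"
    "s \<in> ftensors (frame_span m e) n" "t \<in> ftensors (frame_span m e) n"
    using exists_tensor_frame[OF assms] .
  let ?I = "multi_indices m n"
  let ?L = "\<lambda>s. L2_set (\<lambda>J. cmod (tensor_coord e n s J)) ?I"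
  have tri: "?L a \<le> ?L b + ?L c" if "\<And>J. cmod (tensor_coord e n a J)
     \<le> cmod (tensor_coord e n b J) + cmod (tensor_coord e n c J)" for a b c
    using that by (intro order_trans[OF L2_set_mono L2_set_triangle_ineq]) auto
  have "?L s \<le> ?L t + ?L (s - t)"
    by (rule tri) (simp add: tensor_coord_diff norm_triangle_sub)
  moreover have "?L t \<le> ?L s + ?L (s - t)"
    by (rule tri) (metis tensor_coord_diff norm_minus_commute norm_triangle_sub)
  ultimately show ?thesis
    using me ftensors_diff[OF me(2,3)] by (simp add: tensor_norm_coord[OF me(1)] abs_le_iff)
qed

lemma tensor_bil_coord:
  assumes "s \<in> ftensors (frame_span m e) n"
  shows "tensor_bil inner s (tensor_power_vec \<xi> n)
    = (\<Sum>J\<in>multi_indices m n. tensor_coord e n s J * (\<Prod>i<n. Complex (e (J i) \<bullet> fst \<xi>) (e (J i) \<bullet> snd \<xi>)))"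
proof -
  let ?b = "\<lambda>j. Complex (e j \<bullet> fst \<xi>) (e j \<bullet> snd \<xi>)"
  have "tensor_bil inner s (tensor_power_vec \<xi> n) = (\<Sum>xs\<in>Poly_Mapping.keys s.
     Poly_Mapping.lookup s xs * prod_list (map2 (cbil inner) xs (replicate n \<xi>)))"
    by (simp add: tensor_bil_def tensor_power_vec_def)
  also have "\<dots> = (\<Sum>xs\<in>Poly_Mapping.keys s. Poly_Mapping.lookup s xs *
     (\<Sum>J\<in>multi_indices m n. (\<Prod>i<n. coord e (xs ! i) (J i)) * (\<Prod>i<n. ?b (J i))))"
  proof (intro sum.cong refl arg_cong2[where f = "(*)"])
    fix xs assume "xs \<in> Poly_Mapping.keys s"
    note xs = ftensorsD[OF assms this]
    show "prod_list (map2 (cbil inner) xs (replicate n \<xi>)) =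
       (\<Sum>J\<in>multi_indices m n. (\<Prod>i<n. coord e (xs ! i) (J i)) * (\<Prod>i<n. ?b (J i)))"
      using xs cbil_inner_coord
      by (intro prod_list_map2_sum[where b = "\<lambda>_. ?b"]) auto
  qed
  finally show ?thesis
    by (simp add: tensor_coord_def sum_distrib_left sum_distrib_right mult.assoc)
       (rule sum.swap)
qed

section \<open>The pairing with a tensor power of a vector\<close>

text \<open>
  A supremum of an unbounded set of reals is an unspecified value, so \<open>dual_norm\<close> is only meaningful
  at vectors with this property.
\<close>

definition dual_bounded :: "'h \<times> 'h \<Rightarrow> bool" where
  "dual_bounded \<xi> \<longleftrightarrow> bdd_above ((\<lambda>\<eta>. cmod (cbil inner \<xi> \<eta>)) ` {\<eta>\<in>cplx V. cnorm B \<eta> \<le> 1})"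

lemma cbil_le_dual_norm:
  assumes "dual_bounded \<xi>" "\<eta> \<in> cplx V" "cnorm B \<eta> \<le> 1"
  shows "cmod (cbil inner \<xi> \<eta>) \<le> dual_norm V B \<xi>"
  unfolding dual_norm_def using assms by (intro cSUP_upper) (auto simp: dual_bounded_def)

lemma dual_norm_nonneg:
  assumes "dual_bounded \<xi>" shows "0 \<le> dual_norm V B \<xi>"
proof -
  have "B 0 0 = 0" using eq_0_iff[of 0] subspace_0[OF subspace_V] by simp
  then have "cmod (cbil inner \<xi> 0) \<le> dual_norm V B \<xi>"
    using subspace_0[OF subspace_V]
    by (intro cbil_le_dual_norm[OF assms]) (auto simp: cplx_def zero_prod_def cnorm_def cherm_def)
  then show ?thesis using norm_ge_zero order_trans by blast
qed

text \<open>
  If \<open>b\<^sub>j\<close> are the coordinates of \<open>\<xi>\<close> as a functional and \<open>D \<noteq> 0\<close> is their Euclidean norm, the unit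
  vector \<open>\<Sum> (cnj b\<^sub>j / D) e\<^sub>j\<close> is admissible in the supremum and gives the value \<open>D\<close>.
\<close>

lemma coords_le_dual_norm:
  assumes me: "orthonormal_frame m e" and bdd: "dual_bounded \<xi>"
  shows "(\<Sum>j<m. (cmod (Complex (e j \<bullet> fst \<xi>) (e j \<bullet> snd \<xi>)))\<^sup>2) \<le> (dual_norm V B \<xi>)\<^sup>2"
proof -
  define b where "b j = Complex (e j \<bullet> fst \<xi>) (e j \<bullet> snd \<xi>)" for j
  define D where "D = sqrt (\<Sum>j<m. (cmod (b j))\<^sup>2)"
  have D0: "D \<ge> 0" by (simp add: D_def sum_nonneg)
  have DD: "D\<^sup>2 = (\<Sum>j<m. (cmod (b j))\<^sup>2)" by (simp add: D_def sum_nonneg)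
  have "D \<le> dual_norm V B \<xi>"
  proof (cases "D = 0")
    case True then show ?thesis using dual_norm_nonneg[OF bdd] by simp
  next
    case False
    define c where "c j = cnj (b j) / D" for j
    define \<eta> where "\<eta> = ((\<Sum>j<m. Re (c j) *\<^sub>R e j), (\<Sum>j<m. Im (c j) *\<^sub>R e j))"
    have eV: "\<And>i. i < m \<Longrightarrow> e i \<in> V"
      and on: "\<And>i j. i < m \<Longrightarrow> j < m \<Longrightarrow> B (e i) (e j) = (if i = j then 1 else 0)"
      using me by (auto simp: orthonormal_frame_def)
    have B: "B (\<Sum>j<m. r j *\<^sub>R e j) (e k) = r k" if "k < m" for r k
    proof -
      have "B (\<Sum>j<m. r j *\<^sub>R e j) (e k) = (\<Sum>j<m. r j * B (e j) (e k))"
        using eV that by (intro sum_scale_left) auto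
      also have "\<dots> = (\<Sum>j<m. r j * (if j = k then 1 else 0))" using on that by simp
      finally show ?thesis using that by (simp add: if_distrib cong: if_cong)
    qed
    have "(\<Sum>j<m. r j *\<^sub>R e j) \<in> frame_span m e" for r
      using eV B by (auto simp: frame_span_def intro!: subspace_sum subspace_scale subspace_V)
    then have \<eta>: "\<eta> \<in> cplx (frame_span m e)" by (simp add: \<eta>_def cplx_def)
    have co: "coord e \<eta> j = c j" if "j < m" for j
      using B[OF that] by (simp add: coord_def \<eta>_def)
    have "cherm B \<eta> \<eta> = of_real ((\<Sum>j<m. (cmod (b j))\<^sup>2) / D\<^sup>2)"
    proof -
      have "cherm B \<eta> \<eta> = (\<Sum>j<m. of_real ((cmod (c j))\<^sup>2))"
        unfolding cherm_coord[OF me \<eta> \<eta>] complex_norm_square using co by simp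
      also have "\<dots> = of_real (\<Sum>j<m. (cmod (b j))\<^sup>2 / D\<^sup>2)"
        by (simp add: c_def norm_divide power_divide)
      finally show ?thesis by (simp only: sum_divide_distrib)
    qed
    then have "cherm B \<eta> \<eta> = 1" using False by (simp flip: DD)
    then have "cnorm B \<eta> \<le> 1" by (simp add: cnorm_def)
    moreover have "cbil inner \<xi> \<eta> = cbil inner \<eta> \<xi>"
      by (simp add: cbil_def inner_commute)
    moreover have "cbil inner \<eta> \<xi> = of_real ((\<Sum>j<m. (cmod (b j))\<^sup>2) / D)"
    proof -
      have "cbil inner \<eta> \<xi> = (\<Sum>j<m. c j * b j)"
        unfolding cbil_inner_coord[OF \<eta>] b_def[symmetric] using co by simp
      also have "\<dots> = (\<Sum>j<m. of_real ((cmod (b j))\<^sup>2) / of_real D)"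
        unfolding complex_norm_square by (simp add: c_def mult.commute)
      finally show ?thesis by (simp add: sum_divide_distrib)
    qed
    then have "cbil inner \<eta> \<xi> = of_real D"
      unfolding DD[symmetric] using False by (simp add: power2_eq_square)
    ultimately show ?thesis
      using cbil_le_dual_norm[OF bdd, of \<eta>] \<eta> D0 by (auto simp: cplx_def frame_span_def)
  qed
  then show ?thesis using D0 unfolding DD[symmetric] b_def[symmetric] by (simp add: power_mono)
qed

text \<open>
  Cauchy-Schwarz over multi-indices; the squared factor belonging to \<open>\<xi>\<close> is
  \<open>\<Sum>\<^sub>J \<Prod>\<^sub>i \<bar>b (J i)\<bar>\<^sup>2 = (\<Sum>\<^sub>j \<bar>b j\<bar>\<^sup>2)\<^sup>n\<close>.
\<close>

lemma tensor_bil_le: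
  assumes s: "s \<in> ftensors V n" and bdd: "dual_bounded \<xi>"
  shows "cmod (tensor_bil inner s (tensor_power_vec \<xi> n)) \<le> tensor_norm B s * dual_norm V B \<xi> ^ n"
proof -
  obtain m e where me: "orthonormal_frame m e" "s \<in> ftensors (frame_span m e) n"
    using exists_tensor_frame[OF s s] .
  define b where "b j = Complex (e j \<bullet> fst \<xi>) (e j \<bullet> snd \<xi>)" for j
  let ?I = "multi_indices m n"
  have "cmod (tensor_bil inner s (tensor_power_vec \<xi> n))
     \<le> (\<Sum>J\<in>?I. \<bar>cmod (tensor_coord e n s J)\<bar> * \<bar>cmod (\<Prod>i<n. b (J i))\<bar>)"
    unfolding tensor_bil_coord[OF me(2)] b_def[symmetric]
    by (rule order_trans[OF norm_sum]) (simp add: norm_mult)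
  also have "\<dots> \<le> L2_set (\<lambda>J. cmod (tensor_coord e n s J)) ?I * L2_set (\<lambda>J. cmod (\<Prod>i<n. b (J i))) ?I"
    by (rule L2_set_mult_ineq)
  also have "L2_set (\<lambda>J. cmod (\<Prod>i<n. b (J i))) ?I = sqrt ((\<Sum>j<m. (cmod (b j))\<^sup>2) ^ n)"
    using prod_sum_PiE[of "{..<n}" "\<lambda>_. {..<m}" "\<lambda>_ j. (cmod (b j))\<^sup>2"]
    by (simp add: L2_set_def prod_power_distrib flip: prod_norm)
  also have "\<dots> \<le> sqrt (((dual_norm V B \<xi>)\<^sup>2) ^ n)"
    using coords_le_dual_norm[OF me(1) bdd]
    by (auto intro!: power_mono sum_nonneg simp: b_def)
  also have "\<dots> = dual_norm V B \<xi> ^ n"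
    using dual_norm_nonneg[OF bdd] by (simp add: real_sqrt_power)
  finally show ?thesis
    using tensor_norm_coord[OF me] by (simp add: mult_left_mono L2_set_nonneg)
qed

lemma tensor_bil_diff:
  "tensor_bil inner (s - t) (tensor_power_vec \<xi> n)
     = tensor_bil inner s (tensor_power_vec \<xi> n) - tensor_bil inner t (tensor_power_vec \<xi> n)"
proof -
  let ?K = "Poly_Mapping.keys s \<union> Poly_Mapping.keys t"
  let ?f = "\<lambda>s xs. Poly_Mapping.lookup s xs * prod_list (map2 (cbil inner) xs (replicate n \<xi>))"
  have "tensor_bil inner a (tensor_power_vec \<xi> n) = (\<Sum>xs\<in>?K. ?f a xs)"
    if "Poly_Mapping.keys a \<subseteq> ?K" for a
  proof -
    have "tensor_bil inner a (tensor_power_vec \<xi> n) = (\<Sum>xs\<in>Poly_Mapping.keys a. ?f a xs)"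
      by (simp add: tensor_bil_def tensor_power_vec_def)
    also have "\<dots> = (\<Sum>xs\<in>?K. ?f a xs)"
      using that by (intro sum.mono_neutral_left) (simp_all add: not_in_keys_iff_lookup_eq_zero)
    finally show ?thesis .
  qed
  then show ?thesis
    using keys_diff[of s t] by (simp add: lookup_minus sum_subtractf left_diff_distrib)
qed

text \<open>
  Reflexivity of \<open>tensor_eq\<close> makes its classes nonempty, so the chosen representative is a genuine
  member.
\<close>

lemma representative_mem:
  assumes "f \<in> hilbert_tensor_power V B n"
  shows "(SOME s. s \<in> f) \<in> tensor_cauchy V B n"
proof -
  obtain s where s: "s \<in> tensor_cauchy V B n" "f = tensor_eq V B n `` {s}"
    using assms by (auto simp: hilbert_tensor_power_def quotient_def)
  have "(s, s) \<in> tensor_eq V B n"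
    using s by (simp add: tensor_eq_def tensor_norm_def tensor_herm_def)
  then have "s \<in> f" using s by simp
  then have "(SOME s. s \<in> f) \<in> f" by (rule someI[where P = "\<lambda>s. s \<in> f"])
  then show ?thesis using s by (auto simp: tensor_eq_def)
qed

text \<open>
  The reverse triangle inequality turns a Cauchy sequence of tensors into a Cauchy sequence of norms,
  hence the \<open>lim\<close> in the definition of the norm is an actual limit.
\<close>

lemma hilbert_tensor_norm_tendsto:
  assumes f: "f \<in> hilbert_tensor_power V B n"
  shows "(\<lambda>k. tensor_norm B ((SOME s. s \<in> f) k)) \<longlonglongrightarrow> hilbert_tensor_norm B f"
proof -
  define s where "s = (SOME s. s \<in> f)"
  have s: "\<And>k. s k \<in> ftensors V n" 
    "\<And>e. e > 0 \<Longrightarrow> \<exists>N. \<forall>j\<ge>N. \<forall>k\<ge>N. tensor_norm B (s j - s k) < e"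
    using representative_mem[OF f] by (auto simp: s_def[symmetric] tensor_cauchy_def)
  have "Cauchy (\<lambda>k. tensor_norm B (s k))"
    unfolding Cauchy_def dist_real_def
    using s(2) tensor_norm_triangle[OF s(1) s(1)] by (meson order_le_less_trans)
  then show ?thesis
    unfolding hilbert_tensor_norm_def s_def[symmetric]
    by (simp add: Cauchy_convergent_iff convergent_LIMSEQ_iff)
qed

lemma hilbert_tensor_norm_nonneg:
  assumes f: "f \<in> hilbert_tensor_power V B n"
  shows "0 \<le> hilbert_tensor_norm B f"
proof (rule LIMSEQ_le_const[OF hilbert_tensor_norm_tendsto[OF f]])
  have "\<forall>k. (SOME s. s \<in> f) k \<in> ftensors V n"
    using representative_mem[OF f] by (simp add: tensor_cauchy_def)
  then show "\<exists>N. \<forall>k\<ge>N. 0 \<le> tensor_norm B ((SOME s. s \<in> f) k)"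
    using tensor_norm_nonneg by blast
qed

text \<open>
  The estimate for formal tensors, applied to differences, also shows that the pairings converge
  along a representative; the bound then passes to the limit.
\<close>

lemma tensor_pairing_le:
  assumes f: "f \<in> hilbert_tensor_power V B n" and bdd: "dual_bounded \<xi>"
  shows "cmod (tensor_pairing f (tensor_power_vec \<xi> n)) \<le> hilbert_tensor_norm B f * dual_norm V B \<xi> ^ n"
proof -
  define s where "s = (SOME s. s \<in> f)"
  have s: "\<And>k. s k \<in> ftensors V n" 
    "\<And>e. e > 0 \<Longrightarrow> \<exists>N. \<forall>j\<ge>N. \<forall>k\<ge>N. tensor_norm B (s j - s k) < e"
    using representative_mem[OF f] by (auto simp: s_def[symmetric] tensor_cauchy_def)
  define a where "a k = tensor_bil inner (s k) (tensor_power_vec \<xi> n)" for k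
  define d where "d = dual_norm V B \<xi> ^ n"
  have d: "d \<ge> 0" using dual_norm_nonneg[OF bdd] by (simp add: d_def)
  have dist: "dist (a j) (a k) \<le> tensor_norm B (s j - s k) * (d + 1)" for j k
  proof -
    have "dist (a j) (a k) \<le> tensor_norm B (s j - s k) * d"
      using tensor_bil_le[OF ftensors_diff[OF s(1) s(1)] bdd]
      by (simp add: dist_norm a_def d_def tensor_bil_diff)
    also have "\<dots> \<le> tensor_norm B (s j - s k) * (d + 1)"
      using tensor_norm_nonneg[OF ftensors_diff[OF s(1) s(1)]] by (intro mult_left_mono) auto
    finally show ?thesis .
  qed
  have "Cauchy a"
  proof (rule metric_CauchyI)
    fix e :: real assume "e > 0"
    then have "e / (d + 1) > 0" using d by simp
    then obtain N where N: "\<forall>j\<ge>N. \<forall>k\<ge>N. tensor_norm B (s j - s k) < e / (d + 1)"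
      using s(2) by blast
    have "dist (a j) (a k) < e" if "j \<ge> N" "k \<ge> N" for j k
    proof -
      have "tensor_norm B (s j - s k) * (d + 1) < e"
        using N that d by (simp add: pos_less_divide_eq)
      then show ?thesis using dist[of j k] by linarith
    qed
    then show "\<exists>N. \<forall>j\<ge>N. \<forall>k\<ge>N. dist (a j) (a k) < e" by blast
  qed
  then have lim: "a \<longlonglongrightarrow> tensor_pairing f (tensor_power_vec \<xi> n)"
    unfolding tensor_pairing_def a_def s_def[symmetric]
    by (simp add: Cauchy_convergent_iff convergent_LIMSEQ_iff)
  have "(\<lambda>k. tensor_norm B (s k) * d) \<longlonglongrightarrow> hilbert_tensor_norm B f * d"
    using hilbert_tensor_norm_tendsto[OF f] by (intro tendsto_intros) (simp add: s_def)
  moreover have "\<forall>k. cmod (a k) \<le> tensor_norm B (s k) * d"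
    using tensor_bil_le[OF s(1) bdd] by (simp add: a_def d_def)
  ultimately show ?thesis
    using LIMSEQ_le[OF tendsto_norm[OF lim]] by (auto simp: d_def)
qed

end



section \<open>The Legendre transform of a growth function\<close>

lemma C_plus_log_pos: "u \<in> C_plus_log \<Longrightarrow> 0 \<le> r \<Longrightarrow> 0 < u r"
  by (simp add: C_plus_log_def)

lemma legendre_le:
  assumes "u \<in> C_plus_log" and "0 < r"
  shows "legendre u t \<le> u r / r powr t"
  unfolding legendre_def
proof (rule cINF_lower)
  show "bdd_below ((\<lambda>r. u r / r powr t) ` {0<..})"
    using C_plus_log_pos[OF assms(1)] by (intro bdd_belowI2[where m = 0]) (simp add: less_imp_le)
qed (use assms in simp)

text \<open>
  At \<open>r = 0\<close>, which the infimum leaves out, only \<open>n = 0\<close> has content; there it follows from the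
  continuity of \<open>u\<close> at \<open>0\<close>.
\<close>

lemma legendre_times_power_le:
  assumes u: "u \<in> C_plus_log" and "0 \<le> r"
  shows "legendre u (real n) * r ^ n \<le> u r"
proof (cases "r = 0")
  case False
  then have "r > 0" using assms by simp
  then show ?thesis
    using legendre_le[OF u \<open>r > 0\<close>, of "real n"] by (simp add: powr_realpow field_simps)
next
  case r: True
  show ?thesis
  proof (cases "n = 0")
    case True
    have "continuous_on {0..} u" using u by (simp add: C_plus_log_def)
    then have "(u \<longlongrightarrow> u 0) (at 0 within {0..})" by (auto simp: continuous_on_def)
    then have "(u \<longlongrightarrow> u 0) (at_right 0)" by (rule tendsto_within_subset) auto
    moreover have "eventually (\<lambda>s. legendre u 0 \<le> u s) (at_right 0)"
      using legendre_le[OF u, of _ 0] by (auto simp: eventually_at_filter)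
    ultimately have "legendre u 0 \<le> u 0"
      by (intro tendsto_lowerbound) auto
    then show ?thesis using True r by simp
  next
    case False
    then show ?thesis using C_plus_log_pos[OF u, of 0] r by (simp add: power_0_left less_imp_le)
  qed
qed

text \<open>
  Positivity keeps \<open>1 / legendre u n\<close> from being the default value \<open>1 / 0 = 0\<close>. Far out, superpolynomial
  growth makes \<open>u r / r powr t\<close> at least \<open>1\<close>; on the remaining bounded interval the minimum of \<open>u\<close> and
  the largest value of \<open>r powr t\<close> bound the quotient from below.
\<close>

lemma legendre_pos:
  assumes u: "u \<in> C_plus_log" and "0 \<le> t"
  shows "0 < legendre u t"
proof -
  have "filterlim (\<lambda>r. ln (u r) / ln r) at_top at_top" using u by (simp add: C_plus_log_def)
  then have "eventually (\<lambda>r. t \<le> ln (u r) / ln r) at_top" by (simp add: filterlim_at_top)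
  then obtain R0 where R0: "\<And>r. r \<ge> R0 \<Longrightarrow> t \<le> ln (u r) / ln r"
    by (auto simp: eventually_at_top_linorder)
  define R where "R = max R0 2"
  have "0 \<le> R" by (simp add: R_def)
  have "continuous_on {0..R} u"
    using u by (auto simp: C_plus_log_def intro: continuous_on_subset)
  then obtain x where x: "x \<in> {0..R}" "\<And>r. r \<in> {0..R} \<Longrightarrow> u x \<le> u r"
    using continuous_attains_inf[of "{0..R}" u] \<open>0 \<le> R\<close> by (auto)
  have ux: "u x > 0" using x(1) u by (auto intro: C_plus_log_pos)
  have RR: "R powr t > 0" by (simp add: R_def)
  have "min 1 (u x / R powr t) \<le> u r / r powr t" if r: "r > 0" for r
  proof (cases "r \<le> R")
    case True
    have "u x / R powr t \<le> u r / r powr t"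
      using x(2)[of r] r True ux \<open>0 \<le> t\<close> by (intro frac_le) (auto intro: powr_mono2)
    then show ?thesis by linarith
  next
    case False
    then have "ln r > 0" "t \<le> ln (u r) / ln r" using R0 by (auto simp: R_def)
    then have "t * ln r \<le> ln (u r)" by (simp add: pos_le_divide_eq)
    then have "r powr t \<le> u r"
      using r C_plus_log_pos[OF u, of r] by (simp add: powr_def ln_ge_iff)
    then have "1 \<le> u r / r powr t" using r by simp
    then show ?thesis by linarith
  qed
  then have "min 1 (u x / R powr t) \<le> legendre u t"
    unfolding legendre_def by (intro cINF_greatest) auto
  moreover have "0 < min 1 (u x / R powr t)" using ux RR by simp
  ultimately show ?thesis by linarith
qed

section \<open>Weighted Cauchy-Schwarz\<close>

text \<open>
  Split \<open>h\<^sub>n d\<^sup>n = (h\<^sub>n / \<surd>w\<^sub>n) (\<surd>w\<^sub>n d\<^sup>n)\<close>. The second factors are square summable because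
  \<open>w\<^sub>n d\<^sup>2\<^sup>n \<le> \<rho>\<^sup>2\<^sup>n w\<^sub>n d'\<^sup>2\<^sup>n \<le> \<rho>\<^sup>2\<^sup>n U\<close>: the factor \<open>\<rho>\<close> gained in passing from \<open>d'\<close> to \<open>d\<close> makes the
  series geometric.
\<close>

lemma weighted_power_series_bound:
  fixes c :: "nat \<Rightarrow> complex"
  assumes c: "c sums S" and ch: "\<And>n. cmod (c n) \<le> h n * d ^ n"
    and h: "\<And>n. 0 \<le> h n" and w: "\<And>n. 0 < w n"
    and sm: "summable (\<lambda>n. 1 / w n * (h n)\<^sup>2)"
    and d: "0 \<le> d" "d \<le> \<rho> * d'" and \<rho>: "0 < \<rho>" "\<rho> < 1"
    and U: "\<And>n. w n * (d'\<^sup>2) ^ n \<le> U"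
  shows "cmod S \<le> sqrt (suminf (\<lambda>n. 1 / w n * (h n)\<^sup>2)) * sqrt (U / (1 - \<rho>\<^sup>2))"
proof -
  define A where "A = suminf (\<lambda>n. 1 / w n * (h n)\<^sup>2)"
  have \<rho>2: "\<rho>\<^sup>2 < 1" using \<rho> by (simp add: power_less_one_iff)
  have U0: "0 \<le> U" using U[of 0] w[of 0] by simp
  have A: "(\<Sum>n<N. 1 / w n * (h n)\<^sup>2) \<le> A" for N
    unfolding A_def using sm w by (intro sum_le_suminf) (auto simp: less_imp_le)
  have geo: "(\<Sum>n<N. w n * (d ^ n)\<^sup>2) \<le> U / (1 - \<rho>\<^sup>2)" for N
  proof -
    have "w n * (d ^ n)\<^sup>2 \<le> U * (\<rho>\<^sup>2) ^ n" for n
    proof -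
      have "(d ^ n)\<^sup>2 \<le> ((\<rho> * d') ^ n)\<^sup>2" using d by (intro power_mono) auto
      then have "w n * (d ^ n)\<^sup>2 \<le> w n * ((\<rho> * d') ^ n)\<^sup>2"
        using w by (intro mult_left_mono) (auto simp: less_imp_le)
      also have "\<dots> = w n * (d'\<^sup>2) ^ n * (\<rho>\<^sup>2) ^ n"
        by (simp add: power_mult_distrib mult_ac flip: power_mult)
      also have "\<dots> \<le> U * (\<rho>\<^sup>2) ^ n" using U by (intro mult_right_mono) auto
      finally show ?thesis .
    qed
    then have "(\<Sum>n<N. w n * (d ^ n)\<^sup>2) \<le> (\<Sum>n<N. U * (\<rho>\<^sup>2) ^ n)" by (intro sum_mono)
    also have "\<dots> \<le> suminf (\<lambda>n. U * (\<rho>\<^sup>2) ^ n)"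
      using \<rho>2 U0 \<rho> by (intro sum_le_suminf summable_mult summable_geometric) auto
    also have "\<dots> = U / (1 - \<rho>\<^sup>2)"
      using \<rho>2 by (simp add: suminf_mult suminf_geometric summable_geometric)
    finally show ?thesis .
  qed
  have "cmod (\<Sum>n<N. c n) \<le> sqrt A * sqrt (U / (1 - \<rho>\<^sup>2))" for N
  proof -
    have "cmod (\<Sum>n<N. c n) \<le> (\<Sum>n<N. h n * d ^ n)"
      using ch by (intro sum_norm_le) auto
    also have "\<dots> = (\<Sum>n<N. \<bar>h n / sqrt (w n)\<bar> * \<bar>sqrt (w n) * d ^ n\<bar>)"
      using h d w by (intro sum.cong refl) (simp add: abs_mult less_imp_le less_imp_neq[THEN not_sym])
    also have "\<dots> \<le> L2_set (\<lambda>n. h n / sqrt (w n)) {..<N} * L2_set (\<lambda>n. sqrt (w n) * d ^ n) {..<N}"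
      by (rule L2_set_mult_ineq)
    also have "L2_set (\<lambda>n. h n / sqrt (w n)) {..<N} = sqrt (\<Sum>n<N. 1 / w n * (h n)\<^sup>2)"
      using w by (simp add: L2_set_def power_divide less_imp_le)
    also have "L2_set (\<lambda>n. sqrt (w n) * d ^ n) {..<N} = sqrt (\<Sum>n<N. w n * (d ^ n)\<^sup>2)"
      using w by (simp add: L2_set_def power_mult_distrib less_imp_le)
    also have "sqrt (\<Sum>n<N. 1 / w n * (h n)\<^sup>2) * sqrt (\<Sum>n<N. w n * (d ^ n)\<^sup>2)
        \<le> sqrt A * sqrt (U / (1 - \<rho>\<^sup>2))"
      using A[of 0] A geo w by (intro mult_mono real_sqrt_le_mono) (auto intro!: sum_nonneg simp: less_imp_le)
    finally show ?thesis .
  qed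
  moreover have "(\<lambda>N. cmod (\<Sum>n<N. c n)) \<longlonglongrightarrow> cmod S"
    using c by (intro tendsto_norm) (simp add: sums_def)
  ultimately show ?thesis
    unfolding A_def by (intro LIMSEQ_le_const2) auto
qed

lemma geometric_constant_le:
  fixes \<rho> :: real
  assumes "0 < \<rho>" "\<rho> < 1"
  shows "sqrt (1 / (1 - \<rho>\<^sup>2)) \<le> sqrt (exp 1) * (2 * \<rho>\<^sup>2 * ln (1 / \<rho>)) powr (-1/2)"
proof -
  define y where "y = 2 * \<rho>\<^sup>2 * ln (1 / \<rho>)"
  have \<rho>2: "0 < \<rho>\<^sup>2" "\<rho>\<^sup>2 < 1" using assms by (auto simp: power_less_one_iff)
  have y: "y > 0" using assms by (simp add: y_def)
  have "y = \<rho>\<^sup>2 * ln (1 / \<rho>\<^sup>2)"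
    using assms by (simp add: y_def ln_div ln_realpow)
  also have "\<dots> \<le> \<rho>\<^sup>2 * (1 / \<rho>\<^sup>2 - 1)"
    using \<rho>2 by (intro mult_left_mono ln_le_minus_one) auto
  also have "\<dots> = 1 - \<rho>\<^sup>2" using \<rho>2 by (simp add: right_diff_distrib)
  finally have "1 / (1 - \<rho>\<^sup>2) \<le> 1 / y"
    using y by (intro divide_left_mono) (use \<rho>2 in auto)
  also have "\<dots> \<le> exp 1 / y"
    using y by (intro divide_right_mono) auto
  finally have "sqrt (1 / (1 - \<rho>\<^sup>2)) \<le> sqrt (exp 1 / y)" by simp
  also have "\<dots> = sqrt (exp 1) * y powr (-1/2)"
    using y by (simp add: real_sqrt_divide powr_minus_divide powr_half_sqrt)
  finally show ?thesis by (simp add: y_def)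
qed


section \<open>Dual norms along the scale\<close>

context nuclear_scale
begin

lemma inner_product_subspace: "inner_product_subspace (Ep p) (ip p)"
  using subspace_Ep ip by unfold_locales

lemma form_nonneg: "x \<in> Ep p \<Longrightarrow> 0 \<le> ip p x x"
  using inner_product_subspace.nonneg[OF inner_product_subspace] .

lemma form_norm_Suc:
  assumes "x \<in> Ep (Suc p)"
  shows "form_norm (ip p) x \<le> \<rho> * form_norm (ip (Suc p)) x"
proof -
  have "\<rho> ^ p * form_norm (ip p) x \<le> \<rho> ^ p * (\<rho> * form_norm (ip (Suc p)) x)"
    using norm_mono[OF assms] by (simp add: mult_ac)
  then show ?thesis using rho by (simp only: mult_le_cancel_left_pos zero_less_power)
qed

lemma norm_le_form_norm: "x \<in> Ep p \<Longrightarrow> norm x \<le> form_norm (ip p) x"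
proof (induction p)
  case 0
  then show ?case by (simp add: form_norm_def Ep_0 norm_eq_sqrt_inner)
next
  case (Suc p)
  have "norm x \<le> form_norm (ip p) x" using Suc Ep_mono by blast
  also have "\<dots> \<le> \<rho> * form_norm (ip (Suc p)) x" using form_norm_Suc Suc.prems by blast
  also have "\<dots> \<le> 1 * form_norm (ip (Suc p)) x"
    using rho form_nonneg[OF Suc.prems] by (intro mult_right_mono) (auto simp: form_norm_def)
  finally show ?case by simp
qed

lemma cnorm_power2:
  assumes "\<eta> \<in> cplx (Ep p)"
  shows "(cnorm (ip p) \<eta>)\<^sup>2 = (form_norm (ip p) (fst \<eta>))\<^sup>2 + (form_norm (ip p) (snd \<eta>))\<^sup>2"
  using assms form_nonneg by (auto simp: cplx_def cnorm_def cherm_def form_norm_def)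

lemma cnorm_nonneg:
  assumes "\<eta> \<in> cplx (Ep p)" shows "0 \<le> cnorm (ip p) \<eta>"
  using assms form_nonneg by (auto simp: cplx_def cnorm_def cherm_def)

lemma cnorm_Suc:
  assumes \<eta>: "\<eta> \<in> cplx (Ep (Suc p))"
  shows "cnorm (ip p) \<eta> \<le> \<rho> * cnorm (ip (Suc p)) \<eta>"
proof (rule power2_le_imp_le)
  have \<eta>': "\<eta> \<in> cplx (Ep p)" using \<eta> Ep_mono by (auto simp: cplx_def)
  have "(form_norm (ip p) x)\<^sup>2 \<le> \<rho>\<^sup>2 * (form_norm (ip (Suc p)) x)\<^sup>2" if "x \<in> Ep (Suc p)" for x
  proof -
    have "x \<in> Ep p" using that Ep_mono by blast
    then have "0 \<le> form_norm (ip p) x" by (simp add: form_norm_def form_nonneg)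
    then show ?thesis
      using power_mono[OF form_norm_Suc[OF that]] by (simp add: power_mult_distrib)
  qed
  then show "(cnorm (ip p) \<eta>)\<^sup>2 \<le> (\<rho> * cnorm (ip (Suc p)) \<eta>)\<^sup>2"
    using \<eta> unfolding power_mult_distrib cnorm_power2[OF \<eta>] cnorm_power2[OF \<eta>'] distrib_left
    by (intro add_mono) (auto simp: cplx_def)
  show "0 \<le> \<rho> * cnorm (ip (Suc p)) \<eta>" using rho cnorm_nonneg[OF \<eta>] by simp
qed

text \<open>
  On the unit ball of any level the components have \<open>\<E>\<^sub>0\<close>-norm at most \<open>1\<close>, so pairing with a vector
  of the complexified \<open>\<E>\<^sub>0\<close> is bounded there.
\<close>

lemma dual_bounded: "inner_product_subspace.dual_bounded (Ep p) (ip p) \<xi>"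
  unfolding inner_product_subspace.dual_bounded_def[OF inner_product_subspace]
proof (rule bdd_aboveI2)
  fix \<eta> assume "\<eta> \<in> {\<eta> \<in> cplx (Ep p). cnorm (ip p) \<eta> \<le> 1}"
  then have \<eta>: "\<eta> \<in> cplx (Ep p)" "cnorm (ip p) \<eta> \<le> 1" by auto
  have mem: "fst \<eta> \<in> Ep p" "snd \<eta> \<in> Ep p" using \<eta>(1) by (auto simp: cplx_def)
  have "(cnorm (ip p) \<eta>)\<^sup>2 \<le> 1"
    using \<eta> cnorm_nonneg by (simp add: power_le_one)
  then have sq: "(form_norm (ip p) (fst \<eta>))\<^sup>2 \<le> 1\<^sup>2" "(form_norm (ip p) (snd \<eta>))\<^sup>2 \<le> 1\<^sup>2"
    using cnorm_power2[OF \<eta>(1)] zero_le_power2[of "form_norm (ip p) (fst \<eta>)"]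
      zero_le_power2[of "form_norm (ip p) (snd \<eta>)"] unfolding one_power2 by linarith+
  have le1: "norm (fst \<eta>) \<le> 1" "norm (snd \<eta>) \<le> 1"
    using norm_le_form_norm[OF mem(1)] norm_le_form_norm[OF mem(2)]
      sq[THEN power2_le_imp_le] by auto
  have in_le: "\<bar>a \<bullet> b\<bar> \<le> norm a" if "norm b \<le> 1" for a b :: 'h
    using Cauchy_Schwarz_ineq2[of a b] mult_left_mono[OF that norm_ge_zero[of a]] by simp
  have "cmod (cbil inner \<xi> \<eta>) \<le> \<bar>Re (cbil inner \<xi> \<eta>)\<bar> + \<bar>Im (cbil inner \<xi> \<eta>)\<bar>"
    by (rule cmod_le)
  also have "\<dots> \<le> 2 * (norm (fst \<xi>) + norm (snd \<xi>))"
    using in_le[OF le1(1), of "fst \<xi>"] in_le[OF le1(2), of "fst \<xi>"]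
      in_le[OF le1(1), of "snd \<xi>"] in_le[OF le1(2), of "snd \<xi>"]
    by (simp add: cbil_def)
  finally show "cmod (cbil inner \<xi> \<eta>) \<le> 2 * (norm (fst \<xi>) + norm (snd \<xi>))" .
qed

lemmas dual_norm_nonneg =
  inner_product_subspace.dual_norm_nonneg[OF inner_product_subspace dual_bounded]

text \<open>
  An admissible \<open>\<eta>\<close> of level \<open>Suc p\<close> has norm at most \<open>\<rho>\<close> at level \<open>p\<close>, so \<open>\<eta> / \<rho>\<close> is admissible there.
\<close>

lemma dual_norm_Suc: "dual_norm (Ep (Suc p)) (ip (Suc p)) \<xi> \<le> \<rho> * dual_norm (Ep p) (ip p) \<xi>"
  unfolding dual_norm_def[of "Ep (Suc p)"]
proof (rule cSUP_least)
  have "ip (Suc p) 0 0 = 0"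
    using inner_product_subspace.zero_left[OF inner_product_subspace] subspace_0[OF subspace_Ep] .
  then have "0 \<in> {\<eta> \<in> cplx (Ep (Suc p)). cnorm (ip (Suc p)) \<eta> \<le> 1}"
    using subspace_0[OF subspace_Ep] by (auto simp: cplx_def zero_prod_def cnorm_def cherm_def)
  then show "{\<eta> \<in> cplx (Ep (Suc p)). cnorm (ip (Suc p)) \<eta> \<le> 1} \<noteq> {}" by blast
next
  fix \<eta> assume "\<eta> \<in> {\<eta> \<in> cplx (Ep (Suc p)). cnorm (ip (Suc p)) \<eta> \<le> 1}"
  then have \<eta>: "\<eta> \<in> cplx (Ep (Suc p))" "cnorm (ip (Suc p)) \<eta> \<le> 1" by auto
  interpret L: inner_product_subspace "Ep p" "ip p" by (rule inner_product_subspace)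
  define \<zeta> where "\<zeta> = (1 / \<rho>) *\<^sub>R \<eta>"
  have mem: "fst \<eta> \<in> Ep p" "snd \<eta> \<in> Ep p"
    using \<eta>(1) subsetD[OF Ep_mono] by (auto simp: cplx_def)
  have \<zeta>: "\<zeta> \<in> cplx (Ep p)"
    using mem by (simp add: \<zeta>_def cplx_def mem_Times_iff subspace_scale[OF subspace_Ep])
  have sc: "ip p (c *\<^sub>R x) (c *\<^sub>R x) = c\<^sup>2 * ip p x x" if "x \<in> Ep p" for c x
    using that subspace_scale[OF subspace_Ep that, of c]
    by (simp add: L.scale_left L.form_sym[of x "c *\<^sub>R x"] power2_eq_square)
  have "cnorm (ip p) \<zeta> = cnorm (ip p) \<eta> / \<rho>"
    using mem rho
    by (simp add: cnorm_def cherm_def \<zeta>_def sc real_sqrt_divide power_divide flip: add_divide_distrib)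
  also have "\<dots> \<le> 1"
    using order_trans[OF cnorm_Suc[OF \<eta>(1)] mult_left_mono[OF \<eta>(2)]] rho by simp
  finally have "cmod (cbil inner \<xi> \<zeta>) \<le> dual_norm (Ep p) (ip p) \<xi>"
    by (intro L.cbil_le_dual_norm dual_bounded \<zeta>)
  moreover have "cbil inner \<xi> \<eta> = of_real \<rho> * cbil inner \<xi> \<zeta>"
    using rho by (simp add: cbil_def \<zeta>_def complex_eq_iff right_diff_distrib distrib_left)
  ultimately show "cmod (cbil inner \<xi> \<eta>) \<le> \<rho> * dual_norm (Ep p) (ip p) \<xi>"
    using rho by (simp add: norm_mult)
qed

section \<open>Comparison of the two norms\<close>

lemma pointwise_bound:
  assumes u: "u \<in> C_plus_log" and F: "has_expansion E (Ep (Suc p)) (ip (Suc p)) F f"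
    and sm: "summable (\<lambda>n. 1 / legendre u (real n) * (hilbert_tensor_norm (ip (Suc p)) (f n))\<^sup>2)"
    and \<xi>: "\<xi> \<in> cplx E"
  shows "cmod (F \<xi>)
    \<le> sqrt (suminf (\<lambda>n. 1 / legendre u (real n) * (hilbert_tensor_norm (ip (Suc p)) (f n))\<^sup>2))
        * sqrt (u ((dual_norm (Ep p) (ip p) \<xi>)\<^sup>2) / (1 - \<rho>\<^sup>2))"
proof (rule weighted_power_series_bound[where d' = "dual_norm (Ep p) (ip p) \<xi>"])
  interpret L: inner_product_subspace "Ep (Suc p)" "ip (Suc p)" by (rule inner_product_subspace)
  have f: "f n \<in> hilbert_tensor_power (Ep (Suc p)) (ip (Suc p)) n" for n
    using F by (auto simp: has_expansion_def sym_hilbert_tensor_power_def)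
  show "(\<lambda>n. tensor_pairing (f n) (tensor_power_vec \<xi> n)) sums F \<xi>"
    using F \<xi> by (simp add: has_expansion_def)
  show "cmod (tensor_pairing (f n) (tensor_power_vec \<xi> n))
      \<le> hilbert_tensor_norm (ip (Suc p)) (f n) * dual_norm (Ep (Suc p)) (ip (Suc p)) \<xi> ^ n" for n
    by (rule L.tensor_pairing_le[OF f dual_bounded])
  show "0 \<le> hilbert_tensor_norm (ip (Suc p)) (f n)" for n
    by (rule L.hilbert_tensor_norm_nonneg[OF f])
qed (use legendre_pos[OF u] legendre_times_power_le[OF u] sm dual_norm_nonneg dual_norm_Suc rho in auto)

lemma norm_sup_le_coeff_norm:
  assumes u: "u \<in> C_plus_log" and F: "has_expansion E (Ep (Suc p)) (ip (Suc p)) F f"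
    and C: "sqrt (1 / (1 - \<rho>\<^sup>2)) \<le> C"
  shows "norm_sup E Ep ip u p F \<le> ennreal C * coeff_norm u (ip (Suc p)) f"
proof -
  define a where "a n = 1 / legendre u (real n) * (hilbert_tensor_norm (ip (Suc p)) (f n))\<^sup>2" for n
  have \<rho>2: "\<rho>\<^sup>2 < 1" using rho by (simp add: power_less_one_iff)
  have "0 < sqrt (1 / (1 - \<rho>\<^sup>2))" using \<rho>2 by simp
  then have C0: "0 < C" using C by linarith
  show ?thesis
  proof (cases "summable a")
    case False
    then have "coeff_norm u (ip (Suc p)) f = \<infinity>" by (simp add: coeff_norm_def a_def[abs_def] Let_def)
    then show ?thesis using C0 by (simp add: ennreal_mult_top)
  next
    case True
    have A0: "0 \<le> suminf a"
      using True legendre_pos[OF u] by (intro suminf_nonneg) (auto simp: a_def less_imp_le)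
    have cn: "coeff_norm u (ip (Suc p)) f = ennreal (sqrt (suminf a))"
      using True by (simp add: coeff_norm_def a_def[abs_def])
    show ?thesis
      unfolding norm_sup_def cn
    proof (rule SUP_least)
      fix \<xi> assume \<xi>: "\<xi> \<in> cplx E"
      define U where "U = u ((dual_norm (Ep p) (ip p) \<xi>)\<^sup>2)"
      have U: "U > 0" using C_plus_log_pos[OF u] by (simp add: U_def)
      have "cmod (F \<xi>) \<le> sqrt (suminf a) * sqrt (U / (1 - \<rho>\<^sup>2))"
        using pointwise_bound[OF u F _ \<xi>] True by (simp add: a_def[abs_def] U_def)
      then have "cmod (F \<xi>) * U powr (-1/2)
          \<le> sqrt (suminf a) * sqrt (U / (1 - \<rho>\<^sup>2)) * U powr (-1/2)"
        by (intro mult_right_mono) auto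
      also have "\<dots> = sqrt (suminf a) * sqrt (1 / (1 - \<rho>\<^sup>2))"
        using U by (simp add: powr_minus_divide powr_half_sqrt real_sqrt_divide)
      also have "\<dots> \<le> sqrt (suminf a) * C"
        using C A0 by (intro mult_left_mono) auto
      finally show "ennreal (cmod (F \<xi>) * u ((dual_norm (Ep p) (ip p) \<xi>)\<^sup>2) powr (-1/2))
          \<le> ennreal C * ennreal (sqrt (suminf a))"
        using C0 A0 by (simp add: U_def mult.commute ennreal_leI flip: ennreal_mult)
    qed
  qed
qed

text \<open>
  The bound holds for every expansion of \<open>F\<close>, hence for the infimum over all of them: dividing by the
  finite positive constant \<open>C\<close> moves it out of the infimum, also when no expansion exists.
\<close>

lemma norm_sup_le_norm_K:
  assumes u: "u \<in> C_plus_log" and C: "sqrt (1 / (1 - \<rho>\<^sup>2)) \<le> C"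
  shows "norm_sup E Ep ip u p F \<le> ennreal C * norm_K E Ep ip u (Suc p) F"
proof -
  have "0 < sqrt (1 / (1 - \<rho>\<^sup>2))" using rho by (simp add: power_less_one_iff)
  then have "0 < C" using C by linarith
  then have C0: "0 < ennreal C" "ennreal C \<noteq> 0" "ennreal C < top" by auto
  have "norm_sup E Ep ip u p F / ennreal C \<le> norm_K E Ep ip u (Suc p) F"
    unfolding norm_K_def
    by (intro INF_greatest divide_le_posI_ennreal C0 norm_sup_le_coeff_norm[OF u _ C]) auto
  then have "ennreal C * (norm_sup E Ep ip u p F / ennreal C)
      \<le> ennreal C * norm_K E Ep ip u (Suc p) F"
    by (rule mult_left_mono) simp
  moreover have "ennreal C * (norm_sup E Ep ip u p F / ennreal C) = norm_sup E Ep ip u p F"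
    using C0 by (metis ennreal_divide_self ennreal_divide_times mult.commute mult.right_neutral)
  ultimately show ?thesis by simp
qed

end

theorem theorem5p4:
  fixes E :: "'h::{real_inner,complete_space} set"
    and Ep :: "nat \<Rightarrow> 'h set"
    and ip :: "nat \<Rightarrow> 'h \<Rightarrow> 'h \<Rightarrow> real"
    and \<rho> :: real
    and u :: "real \<Rightarrow> real"
    and p :: nat
    and F :: "'h \<times> 'h \<Rightarrow> complex"
  assumes "nuclear_scale E Ep ip \<rho>"
    and "u \<in> C_plus_log"
    and "log_exp_convex u"
    and "p \<ge> 1"
    and "F \<in> space_K E Ep ip u p"
  shows "norm_sup E Ep ip u (p - 1) F
           \<le> ennreal (sqrt (exp 1) * (2 * \<rho>\<^sup>2 * ln (1 / \<rho>)) powr (-1/2)) * norm_K E Ep ip u p F"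
proof -
  interpret nuclear_scale E Ep ip \<rho> by fact
  have "Suc (p - 1) = p" using \<open>p \<ge> 1\<close> by simp
  with norm_sup_le_norm_K[OF \<open>u \<in> C_plus_log\<close> geometric_constant_le[OF rho], of "p - 1" F]
  show ?thesis by simp
qed

end
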